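(* Let $\sigma$ be a propositional signature, and let all formulas be infinitary formulas over $\sigma$. For any set $\mathcal{H}$ of formulas (not required to be bounded) and any formulas $F$, $G$: (a) if $F$ is a theorem of the extended system, then $\mathcal{H}\cup\{F\}$ has the same stable models as $\mathcal{H}$; (b) if $F$ is equivalent to $G$ in the extended system, then $\mathcal{H}\cup\{F\}$ and $\mathcal{H}\cup\{G\}$ have the same stable models.
   Context: Formulas. A propositional signature $\sigma$ is a set of propositional atoms. Put $\mathcal{F}^\sigma_0=\sigma$, and let $\mathcal{F}^\sigma_{i+1}$ ($i\in\mathbb{N}$) be obtained from $\mathcal{F}^\sigma_i$ by adding the expressions $\mathcal{H}^\lor$ (disjunction) and $\mathcal{H}^\land$ (conjunction) for all subsets $\mathcal{H}\subseteq\mathcal{F}^\sigma_i$, of any cardinality, and the expressions $F\rightarrow G$ for all $F,G\in\mathcal{F}^\sigma_i$. The elements of $\bigcup_{i=0}^\infty\mathcal{F}^\sigma_i$ are the (infinitary) formulas over $\sigma$. A set of formulas is bounded if it is contained in some $\mathcal{F}^\sigma_i$; $\mathcal{H}^\land$ and $\mathcal{H}^\lor$ are formulas for bounded $\mathcal{H}$. Abbreviations: $\bot$ is $\emptyset^\lor$; $\neg F$ is $F\rightarrow\bot$; $F\land G$ is $\{F,G\}^\land$; $F\lor G$ is $\{F,G\}^\lor$; $F\leftrightarrow G$ is $(F\rightarrow G)\land(G\rightarrow F)$; for a bounded family $\{F_\alpha\}_{\alpha\in A}$, $\bigwedge_{\alpha\in A}F_\alpha$ is $\{F_\alpha:\alpha\in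 A\}^\land$ and $\bigvee_{\alpha\in A}F_\alpha$ is $\{F_\alpha:\alpha\in A\}^\lor$. Satisfaction. An interpretation is a subset $I\subseteq\sigma$. $I\models p$ iff $p\in I$ for $p\in\sigma$; $I\models\mathcal{H}^\land$ iff $I\models F$ for every $F\in\mathcal{H}$; $I\models\mathcal{H}^\lor$ iff $I\models F$ for some $F\in\mathcal{H}$; $I\models F\rightarrow G$ iff $I\not\models F$ or $I\models G$. $I$ satisfies a set of formulas if it satisfies all its elements. Reduct and stable models. The reduct $F^I$ of $F$ with respect to $I$: for $p\in\sigma$, $p^I=p$ if $I\models p$ and $p^I=\bot$ otherwise; $(\mathcal{H}^\land)^I=\{G^I\mid G\in\mathcal{H}\}^\land$; $(\mathcal{H}^\lor)^I=\{G^I\mid G\in\mathcal{H}\}^\lor$; $(G\rightarrow H)^I=G^I\rightarrow H^I$ if $I\models G\rightarrow H$, and $\bot$ otherwise. For a set $\mathcal{H}$ of formulas, $\mathcal{H}^I=\{G^I\mid G\in\mathcal{H}\}$. $I$ is a stable model of a set $\mathcal{H}$ of formulas if $I$ is minimal with respect to set inclusion among the interpretations satisfying $\mathcal{H}^I$ (in particular $I$ satisfies $\mathcal{H}^I$). Basic system. A sequent is an expression $\Gamma\Rightarrow F$ with $F$ a formula and $\Gamma$ a finite set of formulas (written as a list, comma denoting union); $\Rightarrow F$ (empty $\Gamma$) is identified with $F$. Axioms: all sequents $F\Rightarrow F$. Inference rules ($\mathcal{H}$ ranges over bounded sets of formulas; $\Gamma,\Delta$ over finite sets of formulas): $(\land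 I)$ from $\Gamma\Rightarrow H$ for all $H\in\mathcal{H}$ infer $\Gamma\Rightarrow\mathcal{H}^\land$; $(\land E)$ from $\Gamma\Rightarrow\mathcal{H}^\land$ infer $\Gamma\Rightarrow H$ ($H\in\mathcal{H}$); $(\lor I)$ from $\Gamma\Rightarrow H$ ($H\in\mathcal{H}$) infer $\Gamma\Rightarrow\mathcal{H}^\lor$; $(\lor E)$ from $\Gamma\Rightarrow\mathcal{H}^\lor$ and $\Delta,H\Rightarrow F$ for all $H\in\mathcal{H}$ infer $\Gamma,\Delta\Rightarrow F$; $(\rightarrow I)$ from $\Gamma,F\Rightarrow G$ infer $\Gamma\Rightarrow F\rightarrow G$; $(\rightarrow E)$ from $\Gamma\Rightarrow F$ and $\Delta\Rightarrow F\rightarrow G$ infer $\Gamma,\Delta\Rightarrow G$; $(W)$ from $\Gamma\Rightarrow F$ infer $\Gamma,\Delta\Rightarrow F$. Extended system. It is obtained from the basic system by adding the following axiom schemas (each formula $A$ being identified with the sequent $\Rightarrow A$): (1) $F\lor(F\rightarrow G)\lor\neg G$ for all formulas $F,G$; (2) $\neg\bigwedge_{F\in\mathcal{H}}F\rightarrow\bigvee_{F\in\mathcal{H}}\neg F$ for every bounded set $\mathcal{H}$ of formulas; (3) $\Big(\bigwedge_{i\in I}\bigvee_{F\in\mathcal{H}_i}F\Big)\rightarrow\Big(\bigvee_{\{F_i\}_{i\in I}}\bigwedge_{i\in I}F_i\Big)$ and (4) $\Big(\bigwedge_{\{F_i\}_{i\in I}}\bigvee_{i\in I}F_i\Big)\rightarrow\Big(\bigvee_{i\in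 I}\bigwedge_{F\in\mathcal{H}_i}F\Big)$ for every non-empty family $\{\mathcal{H}_i\}_{i\in I}$ of sets of formulas whose union is bounded, where the outer disjunction in the consequent of (3) and the outer conjunction in the antecedent of (4) extend over all elements $\{F_i\}_{i\in I}$ of the Cartesian product of the family $\{\mathcal{H}_i\}_{i\in I}$ (here $I$ is an index set, not an interpretation). The set of theorems of the extended system is the smallest set of sequents containing all its axioms and closed under the inference rules. Formulas $F$ and $G$ are equivalent in the extended system if $F\leftrightarrow G$ is a theorem of the extended system. *)

theory Defs
  imports
    "HOL-Library.FuncSet"
    "HOL-Library.Equipollence"
    "HOL-Library.Infinite_Typeclass"
    "HOL-Library.Countable_Set"
begin

section \<open>Infinitary formulas\<close>

text \<open>
  The hierarchy of infinitary formulas over an infinite signature has cardinality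
  \<open>\<beth>\<^sub>\<omega>\<close> or more, and HOL cannot be shown to have a type that large.  As usual in HOL, the
  cardinality of sets is therefore measured against a universe, here the infinite type
  \<open>'k\<close>: a set is small if it injects into \<open>'k\<close>, and conjunctions and disjunctions
  are formed of small sets.  The type \<open>'k\<close> is a parameter of everything below.
  As soon as \<open>'k\<close> is at least as large as the set of formulas, smallness
  is no restriction at all on sets of formulas and all definitions are literally the ones for subsets of
  any cardinality (lemmas \<open>small_if_large\<close> to \<open>schema_conditions_if_large\<close>); for a finite
  signature this is the case for every \<open>'k\<close> (lemma \<open>formulas_finite_signature\<close>).

  The constructors \<open>ConjFam\<close> and \<open>DisjFam\<close> take a family of formulas rather than a
  set.  Formulas proper use only one selected family for each set, so that
  \<open>Conj\<close> and \<open>Disj\<close> below are injective on small sets.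
\<close>

datatype ('a, 'k) formula =
    Atom 'a
  | ConjFam "'k set" "'k \<Rightarrow> ('a, 'k) formula"
  | DisjFam "'k set" "'k \<Rightarrow> ('a, 'k) formula"
  | Imp "('a, 'k) formula" "('a, 'k) formula"

definition small :: "('a, 'k) formula set \<Rightarrow> bool" where
  "small H \<longleftrightarrow> H \<lesssim> (UNIV :: 'k set)"

definition family_of :: "('a, 'k) formula set \<Rightarrow> 'k set \<times> ('k \<Rightarrow> ('a, 'k) formula)" where
  "family_of H = (SOME (K, f). f ` K = H)"

definition Conj :: "('a, 'k) formula set \<Rightarrow> ('a, 'k) formula" where
  "Conj H = (case family_of H of (K, f) \<Rightarrow> ConjFam K f)"

definition Disj :: "('a, 'k) formula set \<Rightarrow> ('a, 'k) formula" where
  "Disj H = (case family_of H of (K, f) \<Rightarrow> DisjFam K f)"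

primrec formulas_upto :: "'a set \<Rightarrow> nat \<Rightarrow> ('a, 'k) formula set" where
  "formulas_upto \<sigma> 0 = Atom ` \<sigma>"
| "formulas_upto \<sigma> (Suc i) = formulas_upto \<sigma> i
     \<union> {Disj H | H. H \<subseteq> formulas_upto \<sigma> i \<and> small H}
     \<union> {Conj H | H. H \<subseteq> formulas_upto \<sigma> i \<and> small H}
     \<union> {Imp F G | F G. F \<in> formulas_upto \<sigma> i \<and> G \<in> formulas_upto \<sigma> i}"

definition formulas :: "'a set \<Rightarrow> ('a, 'k) formula set" where
  "formulas \<sigma> = (\<Union>i. formulas_upto \<sigma> i)"

definition bounded_set :: "'a set \<Rightarrow> ('a, 'k) formula set \<Rightarrow> bool" where
  "bounded_set \<sigma> H \<longleftrightarrow> small H \<and> (\<exists>i. H \<subseteq> formulas_upto \<sigma> i)"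

definition Bot :: "('a, 'k) formula" where
  "Bot = Disj {}"

definition Neg :: "('a, 'k) formula \<Rightarrow> ('a, 'k) formula" where
  "Neg F = Imp F Bot"

definition And :: "('a, 'k) formula \<Rightarrow> ('a, 'k) formula \<Rightarrow> ('a, 'k) formula" where
  "And F G = Conj {F, G}"

definition Or :: "('a, 'k) formula \<Rightarrow> ('a, 'k) formula \<Rightarrow> ('a, 'k) formula" where
  "Or F G = Disj {F, G}"

definition Iff :: "('a, 'k) formula \<Rightarrow> ('a, 'k) formula \<Rightarrow> ('a, 'k) formula" where
  "Iff F G = And (Imp F G) (Imp G F)"

lemma family_of_small:
  fixes H :: "('a, 'k) formula set"
  assumes "small H"
  obtains K f where "family_of H = (K, f)" and "f ` K = H"
proof -
  from assms obtain g where "H \<subseteq> g ` (UNIV :: 'k set)"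
    by (auto simp: small_def lepoll_iff)
  then have "g ` {k. g k \<in> H} = H" by auto
  then have "\<exists>p :: 'k set \<times> ('k \<Rightarrow> ('a, 'k) formula). case p of (K, f) \<Rightarrow> f ` K = H"
    by (intro exI[of _ "({k. g k \<in> H}, g)"]) simp
  then have "case family_of H of (K, f) \<Rightarrow> f ` K = H"
    unfolding family_of_def by (rule someI_ex)
  with that show ?thesis by (cases "family_of H") simp
qed

lemma family_of_inject:
  assumes "small H" and "small H'" and "family_of H = family_of H'"
  shows "H = H'"
proof -
  obtain K f where *: "family_of H = (K, f)" "f ` K = H"
    using assms(1) by (rule family_of_small)
  obtain K' f' where **: "family_of H' = (K', f')" "f' ` K' = H'"
    using assms(2) by (rule family_of_small)
  from assms(3) have "K = K'" "f = f'" by (simp_all only: *(1) **(1) prod.inject)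
  with *(2) **(2) show ?thesis by (simp only:)
qed

lemma Conj_inject: "small H \<Longrightarrow> small H' \<Longrightarrow> Conj H = Conj H' \<longleftrightarrow> H = H'"
  unfolding Conj_def
  by (cases "family_of H"; cases "family_of H'") (metis (no_types, lifting) family_of_inject formula.inject(2) prod.case)

lemma Disj_inject: "small H \<Longrightarrow> small H' \<Longrightarrow> Disj H = Disj H' \<longleftrightarrow> H = H'"
  unfolding Disj_def
  by (cases "family_of H"; cases "family_of H'") (metis (no_types, lifting) family_of_inject formula.inject(3) prod.case)

lemma Conj_Disj_distinct [simp]:
  "Conj H \<noteq> Disj H'" "Conj H \<noteq> Atom p" "Disj H \<noteq> Atom p" "Conj H \<noteq> Imp F G" "Disj H \<noteq> Imp F G"
  by (auto simp: Conj_def Disj_def split: prod.splits)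

lemma small_subset: "small H \<Longrightarrow> H' \<subseteq> H \<Longrightarrow> small H'"
  unfolding small_def by (rule lepoll_trans[OF subset_imp_lepoll])

lemma small_image_index: "small (f ` (K :: 'k set))" for f :: "'k \<Rightarrow> ('a, 'k) formula"
  unfolding small_def by (rule lepoll_trans[OF image_lepoll subset_imp_lepoll]) simp

lemma small_image: "small H \<Longrightarrow> small (f ` H)"
  for H :: "('a, 'k) formula set" and f :: "('a, 'k) formula \<Rightarrow> ('a, 'k) formula"
  unfolding small_def by (rule lepoll_trans[OF image_lepoll])

lemma small_finite: "finite H \<Longrightarrow> small H" for H :: "('a, 'k::infinite) formula set"
  unfolding small_def by (simp add: finite_lepoll_infinite infinite_UNIV)

section \<open>Satisfaction, reducts and stable models\<close>

primrec sat :: "'a set \<Rightarrow> ('a, 'k) formula \<Rightarrow> bool" where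
  "sat I (Atom p) \<longleftrightarrow> p \<in> I"
| "sat I (ConjFam K f) \<longleftrightarrow> (\<forall>k\<in>K. sat I (f k))"
| "sat I (DisjFam K f) \<longleftrightarrow> (\<exists>k\<in>K. sat I (f k))"
| "sat I (Imp F G) \<longleftrightarrow> (\<not> sat I F \<or> sat I G)"

primrec reduct :: "'a set \<Rightarrow> ('a, 'k) formula \<Rightarrow> ('a, 'k) formula" where
  "reduct I (Atom p) = (if sat I (Atom p :: ('a, 'k) formula) then Atom p else Bot)"
| "reduct I (ConjFam K f) = Conj ((\<lambda>k. reduct I (f k)) ` K)"
| "reduct I (DisjFam K f) = Disj ((\<lambda>k. reduct I (f k)) ` K)"
| "reduct I (Imp F G) = (if sat I (Imp F G) then Imp (reduct I F) (reduct I G) else Bot)"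

lemma sat_Conj: "small H \<Longrightarrow> sat I (Conj H) \<longleftrightarrow> (\<forall>F\<in>H. sat I F)"
  by (erule family_of_small) (auto simp: Conj_def)

lemma sat_Disj: "small H \<Longrightarrow> sat I (Disj H) \<longleftrightarrow> (\<exists>F\<in>H. sat I F)"
  by (erule family_of_small) (auto simp: Disj_def)

lemma reduct_Conj:
  assumes "small H"
  shows "reduct I (Conj H) = Conj (reduct I ` H)"
proof -
  from assms obtain K f where *: "family_of H = (K, f)" "f ` K = H" by (rule family_of_small)
  have "reduct I (Conj H) = Conj ((\<lambda>k. reduct I (f k)) ` K)" unfolding Conj_def[of H] * by simp
  then show ?thesis by (simp only: *(2)[symmetric] image_image)
qed

lemma reduct_Disj:
  assumes "small H"
  shows "reduct I (Disj H) = Disj (reduct I ` H)"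
proof -
  from assms obtain K f where *: "family_of H = (K, f)" "f ` K = H" by (rule family_of_small)
  have "reduct I (Disj H) = Disj ((\<lambda>k. reduct I (f k)) ` K)" unfolding Disj_def[of H] * by simp
  then show ?thesis by (simp only: *(2)[symmetric] image_image)
qed

definition sat_set :: "'a set \<Rightarrow> ('a, 'k) formula set \<Rightarrow> bool" where
  "sat_set I H \<longleftrightarrow> (\<forall>F\<in>H. sat I F)"

definition stable_model :: "'a set \<Rightarrow> ('a, 'k) formula set \<Rightarrow> 'a set \<Rightarrow> bool" where
  "stable_model \<sigma> H I \<longleftrightarrow>
     I \<subseteq> \<sigma> \<and> sat_set I (reduct I ` H) \<and>
     (\<forall>J. J \<subseteq> \<sigma> \<and> sat_set J (reduct I ` H) \<and> J \<subseteq> I \<longrightarrow> J = I)"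

section \<open>The deductive systems\<close>

text \<open>
  \<open>derives \<sigma> Ax \<Gamma> F\<close>: the sequent \<open>\<Gamma> \<Rightarrow> F\<close> is a theorem of the basic system over
  \<open>\<sigma>\<close> extended by the formulas in \<open>Ax\<close> as axioms.
\<close>

inductive derives ::
  "'a set \<Rightarrow> ('a, 'k) formula set \<Rightarrow> ('a, 'k) formula set \<Rightarrow> ('a, 'k) formula \<Rightarrow> bool"
  for \<sigma> :: "'a set" and Ax :: "('a, 'k) formula set"
where
  hypothesis: "F \<in> formulas \<sigma> \<Longrightarrow> derives \<sigma> Ax {F} F"
| extra_axiom: "A \<in> Ax \<Longrightarrow> derives \<sigma> Ax {} A"
| and_intro: "\<lbrakk>bounded_set \<sigma> H; finite \<Gamma>; \<Gamma> \<subseteq> formulas \<sigma>; \<And>G. G \<in> H \<Longrightarrow> derives \<sigma> Ax \<Gamma> G\<rbrakk>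
    \<Longrightarrow> derives \<sigma> Ax \<Gamma> (Conj H)"
| and_elim: "\<lbrakk>bounded_set \<sigma> H; derives \<sigma> Ax \<Gamma> (Conj H); G \<in> H\<rbrakk> \<Longrightarrow> derives \<sigma> Ax \<Gamma> G"
| or_intro: "\<lbrakk>bounded_set \<sigma> H; derives \<sigma> Ax \<Gamma> G; G \<in> H\<rbrakk> \<Longrightarrow> derives \<sigma> Ax \<Gamma> (Disj H)"
| or_elim: "\<lbrakk>bounded_set \<sigma> H; finite \<Delta>; \<Delta> \<subseteq> formulas \<sigma>; F \<in> formulas \<sigma>;
     derives \<sigma> Ax \<Gamma> (Disj H); \<And>G. G \<in> H \<Longrightarrow> derives \<sigma> Ax (\<Delta> \<union> {G}) F\<rbrakk>
    \<Longrightarrow> derives \<sigma> Ax (\<Gamma> \<union> \<Delta>) F"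
| imp_intro: "derives \<sigma> Ax (\<Gamma> \<union> {F}) G \<Longrightarrow> derives \<sigma> Ax \<Gamma> (Imp F G)"
| imp_elim: "\<lbrakk>derives \<sigma> Ax \<Gamma> F; derives \<sigma> Ax \<Delta> (Imp F G)\<rbrakk> \<Longrightarrow> derives \<sigma> Ax (\<Gamma> \<union> \<Delta>) G"
| weakening: "\<lbrakk>derives \<sigma> Ax \<Gamma> F; finite \<Delta>; \<Delta> \<subseteq> formulas \<sigma>\<rbrakk> \<Longrightarrow> derives \<sigma> Ax (\<Gamma> \<union> \<Delta>) F"

text \<open>
  The index sets in the distributivity schemas range over subsets of the type
  \<open>('a, 'k) formula set \<times> ('a, 'k) formula\<close>; by lemma \<open>distributivity_reindex\<close> below,
  index sets of any other type do not yield further axioms.  The premises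
  \<open>bounded_set\<close> other than the one on the union only say that the axiom is a formula.
\<close>

inductive_set ext_axioms :: "'a set \<Rightarrow> ('a, 'k) formula set" for \<sigma> :: "'a set" where
  hosoi: "\<lbrakk>F \<in> formulas \<sigma>; G \<in> formulas \<sigma>\<rbrakk>
    \<Longrightarrow> Or (Or F (Imp F G)) (Neg G) \<in> ext_axioms \<sigma>"
| de_morgan: "bounded_set \<sigma> H
    \<Longrightarrow> Imp (Neg (Conj H)) (Disj (Neg ` H)) \<in> ext_axioms \<sigma>"
| distrib_conj_disj:
    "\<lbrakk>I \<noteq> ({} :: (('a, 'k) formula set \<times> ('a, 'k) formula) set);
      bounded_set \<sigma> (\<Union>i\<in>I. Hs i);
      bounded_set \<sigma> ((\<lambda>i. Disj (Hs i)) ` I);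
      bounded_set \<sigma> ((\<lambda>f. Conj (f ` I)) ` (\<Pi>\<^sub>E i\<in>I. Hs i))\<rbrakk>
    \<Longrightarrow> Imp (Conj ((\<lambda>i. Disj (Hs i)) ` I))
            (Disj ((\<lambda>f. Conj (f ` I)) ` (\<Pi>\<^sub>E i\<in>I. Hs i))) \<in> ext_axioms \<sigma>"
| distrib_disj_conj:
    "\<lbrakk>I \<noteq> ({} :: (('a, 'k) formula set \<times> ('a, 'k) formula) set);
      bounded_set \<sigma> (\<Union>i\<in>I. Hs i);
      bounded_set \<sigma> ((\<lambda>f. Disj (f ` I)) ` (\<Pi>\<^sub>E i\<in>I. Hs i));
      bounded_set \<sigma> ((\<lambda>i. Conj (Hs i)) ` I)\<rbrakk>
    \<Longrightarrow> Imp (Conj ((\<lambda>f. Disj (f ` I)) ` (\<Pi>\<^sub>E i\<in>I. Hs i)))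
            (Disj ((\<lambda>i. Conj (Hs i)) ` I)) \<in> ext_axioms \<sigma>"

definition ext_theorem :: "'a set \<Rightarrow> ('a, 'k) formula \<Rightarrow> bool" where
  "ext_theorem \<sigma> F \<longleftrightarrow> derives \<sigma> (ext_axioms \<sigma>) {} F"

definition ext_equivalent :: "'a set \<Rightarrow> ('a, 'k) formula \<Rightarrow> ('a, 'k) formula \<Rightarrow> bool" where
  "ext_equivalent \<sigma> F G \<longleftrightarrow> ext_theorem \<sigma> (Iff F G)"

section \<open>Adequacy of the encoding\<close>

lemma formulas_upto_mono: "i \<le> j \<Longrightarrow> formulas_upto \<sigma> i \<subseteq> formulas_upto \<sigma> j"
  by (rule lift_Suc_mono_le[where f = "formulas_upto \<sigma>"]) auto

lemma small_if_large:
  fixes \<sigma> :: "'a set"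
  assumes "(formulas \<sigma> :: ('a, 'k) formula set) \<lesssim> (UNIV :: 'k set)"
    and "H \<subseteq> (formulas \<sigma> :: ('a, 'k) formula set)"
  shows "small H"
  using lepoll_trans[OF subset_imp_lepoll[OF assms(2)] assms(1)] unfolding small_def .

lemma formulas_upto_Suc_if_large:
  fixes \<sigma> :: "'a set"
  assumes "(formulas \<sigma> :: ('a, 'k) formula set) \<lesssim> (UNIV :: 'k set)"
  shows "(formulas_upto \<sigma> (Suc i) :: ('a, 'k) formula set) = formulas_upto \<sigma> i
     \<union> Disj ` Pow (formulas_upto \<sigma> i) \<union> Conj ` Pow (formulas_upto \<sigma> i)
     \<union> {Imp F G | F G. F \<in> formulas_upto \<sigma> i \<and> G \<in> formulas_upto \<sigma> i}"
proof -
  have *: "(H \<subseteq> formulas_upto \<sigma> i \<and> small H) = (H \<subseteq> formulas_upto \<sigma> i)"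
    for H :: "('a, 'k) formula set"
    using small_if_large[OF assms, of H] by (auto simp: formulas_def)
  show ?thesis unfolding formulas_upto.simps * by auto
qed

lemma bounded_set_if_large:
  fixes \<sigma> :: "'a set" and H :: "('a, 'k) formula set"
  assumes "(formulas \<sigma> :: ('a, 'k) formula set) \<lesssim> (UNIV :: 'k set)"
  shows "bounded_set \<sigma> H \<longleftrightarrow> (\<exists>i. H \<subseteq> formulas_upto \<sigma> i)"
  using small_if_large[OF assms, of H] by (auto simp: bounded_set_def formulas_def)

lemma schema_conditions_if_large:
  fixes \<sigma> :: "'a set" and Hs :: "'j \<Rightarrow> ('a, 'k) formula set"
  assumes large: "(formulas \<sigma> :: ('a, 'k) formula set) \<lesssim> (UNIV :: 'k set)"
    and un: "bounded_set \<sigma> (\<Union>i\<in>I. Hs i)"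
  shows "bounded_set \<sigma> ((\<lambda>i. Disj (Hs i)) ` I)"
    and "bounded_set \<sigma> ((\<lambda>i. Conj (Hs i)) ` I)"
    and "bounded_set \<sigma> ((\<lambda>f. Conj (f ` I)) ` (\<Pi>\<^sub>E i\<in>I. Hs i))"
    and "bounded_set \<sigma> ((\<lambda>f. Disj (f ` I)) ` (\<Pi>\<^sub>E i\<in>I. Hs i))"
proof -
  obtain n where n: "(\<Union>i\<in>I. Hs i) \<subseteq> formulas_upto \<sigma> n"
    using un by (auto simp: bounded_set_def)
  have f: "f ` I \<subseteq> formulas_upto \<sigma> n" if "f \<in> (\<Pi>\<^sub>E i\<in>I. Hs i)" for f
    using that n by (fastforce simp: PiE_iff)
  have h: "Hs i \<subseteq> formulas_upto \<sigma> n" if "i \<in> I" for i using that n by auto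
  show "bounded_set \<sigma> ((\<lambda>i. Disj (Hs i)) ` I)" "bounded_set \<sigma> ((\<lambda>i. Conj (Hs i)) ` I)"
    unfolding bounded_set_if_large[OF large]
    by (rule exI[of _ "Suc n"], use h in \<open>auto simp: formulas_upto_Suc_if_large[OF large] simp del: formulas_upto.simps\<close>)+
  show "bounded_set \<sigma> ((\<lambda>f. Conj (f ` I)) ` (\<Pi>\<^sub>E i\<in>I. Hs i))"
    "bounded_set \<sigma> ((\<lambda>f. Disj (f ` I)) ` (\<Pi>\<^sub>E i\<in>I. Hs i))"
    unfolding bounded_set_if_large[OF large]
    by (rule exI[of _ "Suc n"], use f in \<open>auto simp: formulas_upto_Suc_if_large[OF large] simp del: formulas_upto.simps\<close>)+
qed

lemma formulas_finite_signature:
  fixes \<sigma> :: "'a set"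
  assumes "finite \<sigma>"
  shows "(formulas \<sigma> :: ('a, 'k::infinite) formula set) \<lesssim> (UNIV :: 'k set)"
proof -
  have "finite (formulas_upto \<sigma> i :: ('a, 'k) formula set)" for i
  proof (induction i)
    case (Suc i)
    let ?L = "formulas_upto \<sigma> i :: ('a, 'k) formula set"
    have "formulas_upto \<sigma> (Suc i) \<subseteq> ?L \<union> Disj ` Pow ?L \<union> Conj ` Pow ?L
        \<union> (\<lambda>(F, G). Imp F G) ` (?L \<times> ?L)"
      by auto
    then show ?case by (rule finite_subset) (use Suc in auto)
  qed (use assms in simp)
  then have "countable (formulas \<sigma> :: ('a, 'k) formula set)"
    unfolding formulas_def by (intro countable_UN) (auto intro: countable_finite)
  then have "(formulas \<sigma> :: ('a, 'k) formula set) \<lesssim> (UNIV :: nat set)"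
    by (auto simp: countable_def lepoll_def)
  also have "(UNIV :: nat set) \<lesssim> (UNIV :: 'k set)"
    using infinite_UNIV infinite_le_lepoll by blast
  finally show ?thesis .
qed

text \<open>
  A distributivity axiom depends on the family \<open>{H\<^sub>i}\<^sub>i\<close> only through the set
  of all \<open>H\<^sub>i\<close> and the set of all ranges of choice functions.
\<close>

lemma choice_ranges_mono:
  assumes sub: "Hs ` I = Hs' ` I'"
    and cls: "\<And>X S. \<lbrakk>X \<in> Hs ` I; S \<subseteq> X; S \<noteq> {}; S \<lesssim> {i \<in> I. Hs i = X}\<rbrakk> \<Longrightarrow> S \<lesssim> {i \<in> I'. Hs' i = X}"
  shows "(\<lambda>f. f ` I) ` (\<Pi>\<^sub>E i\<in>I. Hs i) \<subseteq> (\<lambda>f. f ` I') ` (\<Pi>\<^sub>E i\<in>I'. Hs' i)"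
proof
  fix R assume "R \<in> (\<lambda>f. f ` I) ` (\<Pi>\<^sub>E i\<in>I. Hs i)"
  then obtain f where f: "f \<in> (\<Pi>\<^sub>E i\<in>I. Hs i)" and R: "R = f ` I" by auto
  define S where "S X = f ` {i \<in> I. Hs i = X}" for X
  have "\<exists>g. g ` {i \<in> I'. Hs' i = X} = S X" if X: "X \<in> Hs ` I" for X
  proof -
    have 1: "S X \<subseteq> X" using f by (auto simp: S_def PiE_iff)
    have 2: "S X \<noteq> {}" using X by (auto simp: S_def)
    have "S X \<lesssim> {i \<in> I. Hs i = X}" unfolding S_def by (rule image_lepoll)
    from cls[OF X 1 2 this] obtain g where g: "S X \<subseteq> g ` {i \<in> I'. Hs' i = X}"
      by (auto simp: lepoll_iff)
    obtain s where s: "s \<in> S X" using 2 by auto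
    have "(\<lambda>i. if g i \<in> S X then g i else s) ` {i \<in> I'. Hs' i = X} = S X"
    proof
      show "S X \<subseteq> (\<lambda>i. if g i \<in> S X then g i else s) ` {i \<in> I'. Hs' i = X}"
      proof
        fix r assume r: "r \<in> S X"
        with g obtain i where "i \<in> {i \<in> I'. Hs' i = X}" "r = g i" by blast
        with r show "r \<in> (\<lambda>i. if g i \<in> S X then g i else s) ` {i \<in> I'. Hs' i = X}"
          by (intro image_eqI[of _ _ i]) auto
      qed
    qed (use s in auto)
    then show ?thesis by blast
  qed
  then obtain g where g: "\<And>X. X \<in> Hs ` I \<Longrightarrow> g X ` {i \<in> I'. Hs' i = X} = S X" by metis
  define f' where "f' = restrict (\<lambda>i. g (Hs' i) i) I'"
  have mem: "g (Hs' i) i \<in> S (Hs' i)" if "i \<in> I'" for i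
    using g[of "Hs' i"] that sub by blast
  have "f' \<in> (\<Pi>\<^sub>E i\<in>I'. Hs' i)"
    using mem f by (fastforce simp: f'_def S_def PiE_iff)
  moreover have "f' ` I' = R"
  proof
    show "f' ` I' \<subseteq> R" using mem by (fastforce simp: f'_def R S_def)
    show "R \<subseteq> f' ` I'"
    proof
      fix r assume "r \<in> R"
      then obtain i where i: "i \<in> I" "r = f i" using R by auto
      then have "r \<in> g (Hs i) ` {j \<in> I'. Hs' j = Hs i}" using g[of "Hs i"] by (auto simp: S_def)
      then obtain j where j: "j \<in> I'" "Hs' j = Hs i" "r = g (Hs i) j" by blast
      then have "r = f' j" by (simp add: f'_def)
      with j(1) show "r \<in> f' ` I'" by (rule image_eqI[rotated])
    qed
  qed
  ultimately show "R \<in> (\<lambda>f. f ` I') ` (\<Pi>\<^sub>E i\<in>I'. Hs' i)" by blast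
qed

lemma distributivity_reindex:
  fixes I :: "'j set" and Hs :: "'j \<Rightarrow> 'f set"
  obtains I' :: "('f set \<times> 'f) set" and Hs' :: "'f set \<times> 'f \<Rightarrow> 'f set"
  where "Hs' ` I' = Hs ` I"
    and "(\<lambda>f. f ` I') ` (\<Pi>\<^sub>E i\<in>I'. Hs' i) = (\<lambda>f. f ` I) ` (\<Pi>\<^sub>E i\<in>I. Hs i)"
proof -
  have "\<exists>M :: 'f set. M \<noteq> {} \<and> M \<lesssim> {i \<in> I. Hs i = X} \<and>
      (\<forall>S \<subseteq> X. S \<lesssim> {i \<in> I. Hs i = X} \<longrightarrow> S \<lesssim> M)" if X: "X \<in> Hs ` I" for X
  proof (cases "X = {}")
    case True
    have "{undefined :: 'f} \<lesssim> {i \<in> I. Hs i = X}"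
      using X by (auto simp: lepoll_def)
    with True show ?thesis by (intro exI[of _ "{undefined}"]) auto
  next
    case False
    show ?thesis
    proof (cases "X \<lesssim> {i \<in> I. Hs i = X}")
      case True
      with False show ?thesis by (intro exI[of _ X]) (auto intro: subset_imp_lepoll)
    next
      case nle: False
      have "{i \<in> I. Hs i = X} \<lesssim> X"
        using nle ordLeq_total[OF card_of_Well_order card_of_Well_order, of X "{i \<in> I. Hs i = X}"]
        unfolding lepoll_def card_of_ordLeq by blast
      then obtain h :: "'j \<Rightarrow> 'f" where h: "inj_on h {i \<in> I. Hs i = X}"
        unfolding lepoll_def by blast
      have ne: "h ` {i \<in> I. Hs i = X} \<noteq> {}" using X by auto
      have tr: "S \<lesssim> h ` {i \<in> I. Hs i = X}" if "S \<lesssim> {i \<in> I. Hs i = X}" for S :: "'f set"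
        by (rule lepoll_trans2[OF that eqpoll_sym[OF inj_on_image_eqpoll_self[OF h]]])
      have all: "\<forall>S\<subseteq>X. S \<lesssim> {i \<in> I. Hs i = X} \<longrightarrow> S \<lesssim> h ` {i \<in> I. Hs i = X}"
        by (intro allI impI) (rule tr)
      show ?thesis
        by (rule exI[of _ "h ` {i \<in> I. Hs i = X}"]) (intro conjI ne image_lepoll all)
    qed
  qed
  then have "\<forall>X \<in> Hs ` I. \<exists>M :: 'f set. M \<noteq> {} \<and> M \<lesssim> {i \<in> I. Hs i = X} \<and>
      (\<forall>S \<subseteq> X. S \<lesssim> {i \<in> I. Hs i = X} \<longrightarrow> S \<lesssim> M)"
    by blast
  from bchoice[OF this] obtain M :: "'f set \<Rightarrow> 'f set" where M:
    "\<And>X. X \<in> Hs ` I \<Longrightarrow> M X \<noteq> {}"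
    "\<And>X. X \<in> Hs ` I \<Longrightarrow> M X \<lesssim> {i \<in> I. Hs i = X}"
    "\<And>X S. \<lbrakk>X \<in> Hs ` I; S \<subseteq> X; S \<lesssim> {i \<in> I. Hs i = X}\<rbrakk> \<Longrightarrow> S \<lesssim> M X"
    by blast
  define I' where "I' = Sigma (Hs ` I) M"
  have im: "fst ` I' = Hs ` I" using M(1) by (force simp: I'_def)
  have "{i \<in> I'. fst i = X} \<approx> M X" if "X \<in> Hs ` I" for X
  proof -
    have "{i \<in> I'. fst i = X} = {X} \<times> M X"
    proof (rule set_eqI)
      fix p show "p \<in> {i \<in> I'. fst i = X} \<longleftrightarrow> p \<in> {X} \<times> M X"
        using that unfolding I'_def by (cases p) (simp only: mem_Collect_eq mem_Sigma_iff fst_conv singleton_iff, blast)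
    qed
    then show ?thesis using times_singleton_eqpoll[of X "M X"] by (simp only:)
  qed
  note cls = this
  have "(\<lambda>f. f ` I') ` (\<Pi>\<^sub>E i\<in>I'. fst i) = (\<lambda>f. f ` I) ` (\<Pi>\<^sub>E i\<in>I. Hs i)"
  proof
    show "(\<lambda>f. f ` I') ` (\<Pi>\<^sub>E i\<in>I'. fst i) \<subseteq> (\<lambda>f. f ` I) ` (\<Pi>\<^sub>E i\<in>I. Hs i)"
      by (rule choice_ranges_mono[OF im], unfold im) (rule lepoll_trans[OF lepoll_trans2[OF _ cls] M(2)])
    show "(\<lambda>f. f ` I) ` (\<Pi>\<^sub>E i\<in>I. Hs i) \<subseteq> (\<lambda>f. f ` I') ` (\<Pi>\<^sub>E i\<in>I'. fst i)"
      by (rule choice_ranges_mono[OF im[symmetric]]) (rule lepoll_trans2[OF M(3) eqpoll_sym[OF cls]])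
  qed
  with im that show ?thesis by blast
qed

end

(*
  For J \<subseteq> I, satisfaction of the reduct F\<^sup>I by J is satisfaction of F in the two-world Kripke model
  (J, I) of the logic of here-and-there: world J sees world I, at which satisfaction is classical.
  The inference rules and the additional axioms of the extended system are sound for these models,
  and stability of I refers to F only through the sets J \<subseteq> I that satisfy F\<^sup>I.
*)
theory Submission
  imports Defs
begin

definition ht_sat :: "'a set \<Rightarrow> 'a set \<Rightarrow> ('a, 'k) formula \<Rightarrow> bool" where
  "ht_sat J I F \<longleftrightarrow> sat J (reduct I F)"

lemma sat_Bot [simp]: "\<not> sat J Bot"
  by (simp add: Bot_def sat_Disj small_def)

lemma reduct_Bot [simp]: "reduct I Bot = Bot"
  by (simp add: Bot_def reduct_Disj small_def)

lemma ht_sat_Conj: "small H \<Longrightarrow> ht_sat J I (Conj H) \<longleftrightarrow> (\<forall>F\<in>H. ht_sat J I F)"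
  by (simp add: ht_sat_def reduct_Conj sat_Conj small_image)

lemma ht_sat_Disj: "small H \<Longrightarrow> ht_sat J I (Disj H) \<longleftrightarrow> (\<exists>F\<in>H. ht_sat J I F)"
  by (simp add: ht_sat_def reduct_Disj sat_Disj small_image)

text \<open>The reduct replaces atoms and implications by \<open>Bot\<close> only where I falsifies
  them, and I falsifies \<open>Bot\<close> as well, so no truth value at I changes.\<close>

lemma ht_sat_refl [simp]: "ht_sat I I F \<longleftrightarrow> sat I F"
  unfolding ht_sat_def
  by (induction F) (auto simp: sat_Conj sat_Disj small_image_index)

text \<open>Persistence from world J to world I: an atom or implication that I falsifies has reduct
  \<open>Bot\<close>, which J cannot satisfy; conjunctions and disjunctions inherit the
  property.\<close>

lemma ht_sat_imp_sat:
  assumes "J \<subseteq> I" and "ht_sat J I F"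
  shows "sat I F"
  using assms(2) unfolding ht_sat_def
proof (induction F)
  case (Atom p)
  then show ?case by (auto split: if_splits)
next
  case (Imp F G)
  then show ?case by (auto split: if_splits)
qed (auto simp: sat_Conj sat_Disj small_image_index)

lemma ht_sat_Imp:
  "ht_sat J I (Imp F G) \<longleftrightarrow> sat I (Imp F G) \<and> (ht_sat J I F \<longrightarrow> ht_sat J I G)"
  by (auto simp: ht_sat_def)

text \<open>Negation is decided at I alone: where I falsifies F, persistence makes J falsify it
  too.\<close>

lemma ht_sat_Neg:
  assumes "J \<subseteq> I"
  shows "ht_sat J I (Neg F) \<longleftrightarrow> \<not> sat I F"
  using ht_sat_imp_sat[OF assms] by (auto simp: Neg_def ht_sat_Imp)

lemma ht_sat_Or:
  fixes F G :: "('a, 'k::infinite) formula"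
  shows "ht_sat J I (Or F G) \<longleftrightarrow> ht_sat J I F \<or> ht_sat J I G"
  by (simp add: Or_def ht_sat_Disj small_finite)

lemma ht_sat_Iff:
  fixes F G :: "('a, 'k::infinite) formula"
  shows "ht_sat J I (Iff F G) \<Longrightarrow> ht_sat J I F \<longleftrightarrow> ht_sat J I G"
  by (auto simp: Iff_def And_def ht_sat_Conj ht_sat_Imp small_finite)

text \<open>The premise ranges over all worlds below I because an implication is tested at J and,
  through the instance J = I, classically at I.\<close>

lemma ht_sat_ImpI:
  assumes "J \<subseteq> I" and "\<And>J. J \<subseteq> I \<Longrightarrow> ht_sat J I F \<Longrightarrow> ht_sat J I G"
  shows "ht_sat J I (Imp F G)"
  using assms(2)[OF assms(1)] assms(2)[OF subset_refl] by (simp add: ht_sat_Imp)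

lemma ht_sat_ext_axiom:
  fixes A :: "('a, 'k::infinite) formula"
  assumes "A \<in> ext_axioms \<sigma>" and "J \<subseteq> I"
  shows "ht_sat J I A"
  using assms
proof (induction arbitrary: J)
  case (hosoi F G)
  \<comment> \<open>If I falsifies G, then \<open>Neg G\<close> holds. Otherwise
    \<open>Imp F G\<close> holds at I, and it holds at J unless J satisfies F, which is the first
    disjunct.\<close>
  then show ?case
    using ht_sat_imp_sat[OF hosoi.prems, of F] by (auto simp: ht_sat_Or ht_sat_Neg ht_sat_Imp)
next
  case (de_morgan H)
  have sm: "small H" using de_morgan by (simp add: bounded_set_def)
  \<comment> \<open>Both sides are decided at I, where the law is classical.\<close>
  show ?case
    by (rule ht_sat_ImpI[OF de_morgan.prems])
      (auto simp: ht_sat_Neg ht_sat_Disj sm small_image sat_Conj)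
next
  case (distrib_conj_disj K Hs)
  have un: "small (\<Union>i\<in>K. Hs i)"
    and sm: "small ((\<lambda>i. Disj (Hs i)) ` K)" "small ((\<lambda>f. Conj (f ` K)) ` (\<Pi>\<^sub>E i\<in>K. Hs i))"
    using distrib_conj_disj.hyps by (simp_all add: bounded_set_def)
  \<comment> \<open>The clauses for \<open>Conj\<close> and \<open>Disj\<close> require smallness,
    which the inner sets inherit from the union.\<close>
  have Hs: "small (Hs i)" if "i \<in> K" for i
    by (rule small_subset[OF un]) (use that in auto)
  have f: "small (f ` K)" if "f \<in> (\<Pi>\<^sub>E i\<in>K. Hs i)" for f
    by (rule small_subset[OF un]) (use that in \<open>auto simp: PiE_iff\<close>)
  show ?case
  proof (rule ht_sat_ImpI[OF distrib_conj_disj.prems])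
    fix J assume "ht_sat J I (Conj ((\<lambda>i. Disj (Hs i)) ` K))"
    then have "\<forall>i\<in>K. \<exists>F. F \<in> Hs i \<and> ht_sat J I F"
      by (auto simp: ht_sat_Conj ht_sat_Disj sm Hs)
    then obtain g where "\<forall>i\<in>K. g i \<in> Hs i \<and> ht_sat J I (g i)" by metis
    \<comment> \<open>Restricting the choice of true disjuncts to K makes it extensional, as
      membership in the product demands.\<close>
    then have g: "restrict g K \<in> (\<Pi>\<^sub>E i\<in>K. Hs i)" "\<forall>i\<in>K. ht_sat J I (restrict g K i)" by auto
    from g(2) have "ht_sat J I (Conj (restrict g K ` K))"
      unfolding ht_sat_Conj[OF f[OF g(1)]] by blast
    then show "ht_sat J I (Disj ((\<lambda>f. Conj (f ` K)) ` (\<Pi>\<^sub>E i\<in>K. Hs i)))"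
      unfolding ht_sat_Disj[OF sm(2)] by (rule bexI[OF _ imageI[OF g(1)]])
  qed
next
  case (distrib_disj_conj K Hs)
  have un: "small (\<Union>i\<in>K. Hs i)"
    and sm: "small ((\<lambda>f. Disj (f ` K)) ` (\<Pi>\<^sub>E i\<in>K. Hs i))" "small ((\<lambda>i. Conj (Hs i)) ` K)"
    using distrib_disj_conj.hyps by (simp_all add: bounded_set_def)
  have Hs: "small (Hs i)" if "i \<in> K" for i
    by (rule small_subset[OF un]) (use that in auto)
  have f: "small (f ` K)" if "f \<in> (\<Pi>\<^sub>E i\<in>K. Hs i)" for f
    by (rule small_subset[OF un]) (use that in \<open>auto simp: PiE_iff\<close>)
  show ?case
  proof (rule ht_sat_ImpI[OF distrib_disj_conj.prems], rule ccontr)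
    fix J
    assume conj: "ht_sat J I (Conj ((\<lambda>f. Disj (f ` K)) ` (\<Pi>\<^sub>E i\<in>K. Hs i)))"
      and "\<not> ht_sat J I (Disj ((\<lambda>i. Conj (Hs i)) ` K))"
    \<comment> \<open>Dually, choosing a false member of each \<open>Hs i\<close> yields a conjunct
      of the antecedent that fails at J.\<close>
    then have "\<forall>i\<in>K. \<exists>F. F \<in> Hs i \<and> \<not> ht_sat J I F"
      by (auto simp: ht_sat_Conj ht_sat_Disj sm Hs)
    then obtain g where "\<forall>i\<in>K. g i \<in> Hs i \<and> \<not> ht_sat J I (g i)" by metis
    then have g: "restrict g K \<in> (\<Pi>\<^sub>E i\<in>K. Hs i)" "\<forall>i\<in>K. \<not> ht_sat J I (restrict g K i)" by auto
    from conj g(1) have "ht_sat J I (Disj (restrict g K ` K))"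
      unfolding ht_sat_Conj[OF sm(1)] by (rule bspec[OF _ imageI])
    with g(2) show False unfolding ht_sat_Disj[OF f[OF g(1)]] by blast
  qed
qed

text \<open>The induction keeps J arbitrary because introducing an implication also needs the
  induction hypothesis at I.\<close>

lemma derives_sound:
  assumes "derives \<sigma> Ax \<Gamma> F"
    and "\<And>A J. A \<in> Ax \<Longrightarrow> J \<subseteq> I \<Longrightarrow> ht_sat J I A"
    and "J \<subseteq> I" and "\<forall>G\<in>\<Gamma>. ht_sat J I G"
  shows "ht_sat J I F"
  using assms(1,3,4)
proof (induction arbitrary: J)
  case (extra_axiom A)
  then show ?case using assms(2) by blast
next
  case (imp_intro \<Gamma> F G)
  \<comment> \<open>The hypotheses in \<Gamma> persist from J to I, so the premise sequent applies
    there.\<close>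
  have "sat I G" if "sat I F"
    using imp_intro.IH[of I] imp_intro.prems that by (auto intro: ht_sat_imp_sat)
  with imp_intro show ?case by (auto simp: ht_sat_Imp)
next
  case (or_elim H \<Delta> F \<Gamma>)
  then have "\<exists>G\<in>H. ht_sat J I G" by (auto simp: bounded_set_def ht_sat_Disj)
  with or_elim show ?case by blast
qed (auto simp: bounded_set_def ht_sat_Conj ht_sat_Disj ht_sat_Imp)

lemma ext_theorem_ht_sat:
  fixes F :: "('a, 'k::infinite) formula"
  assumes "ext_theorem \<sigma> F" and "J \<subseteq> I"
  shows "ht_sat J I F"
  using assms(1) unfolding ext_theorem_def
  by (rule derives_sound[OF _ ht_sat_ext_axiom assms(2)]) simp_all

lemma stable_model_ht_sat:
  "stable_model \<sigma> H I \<longleftrightarrow> I \<subseteq> \<sigma> \<and> (\<forall>F\<in>H. ht_sat I I F) \<and>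
     (\<forall>J \<subseteq> I. J \<subseteq> \<sigma> \<and> (\<forall>F\<in>H. ht_sat J I F) \<longrightarrow> J = I)"
  unfolding stable_model_def sat_set_def ht_sat_def by auto

text \<open>The instance J = I covers satisfaction of the reduct by I itself; the proper subsets
  cover minimality.\<close>

lemma stable_model_cong:
  assumes "\<And>J. J \<subseteq> I \<Longrightarrow> (\<forall>F\<in>H. ht_sat J I F) \<longleftrightarrow> (\<forall>F\<in>H'. ht_sat J I F)"
  shows "stable_model \<sigma> H I \<longleftrightarrow> stable_model \<sigma> H' I"
  unfolding stable_model_ht_sat by (simp only: assms subset_refl cong: imp_cong)

theorem mainTheorem2:
  fixes \<sigma> :: "'a set"
    and H :: "('a, 'k::infinite) formula set"
    and F G :: "('a, 'k) formula"
  assumes "H \<subseteq> formulas \<sigma>" and "F \<in> formulas \<sigma>" and "G \<in> formulas \<sigma>"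
  shows "(ext_theorem \<sigma> F \<longrightarrow>
            (\<forall>I. stable_model \<sigma> (H \<union> {F}) I \<longleftrightarrow> stable_model \<sigma> H I)) \<and>
         (ext_equivalent \<sigma> F G \<longrightarrow>
            (\<forall>I. stable_model \<sigma> (H \<union> {F}) I \<longleftrightarrow> stable_model \<sigma> (H \<union> {G}) I))"
proof (intro conjI impI allI)
  fix I
  assume "ext_theorem \<sigma> F"
  \<comment> \<open>By soundness F holds at every J \<subseteq> I, so adding it excludes no
    world.\<close>
  then show "stable_model \<sigma> (H \<union> {F}) I \<longleftrightarrow> stable_model \<sigma> H I"
    by (intro stable_model_cong) (auto dest: ext_theorem_ht_sat)
next
  fix I
  assume "ext_equivalent \<sigma> F G"
  then have "ht_sat J I F \<longleftrightarrow> ht_sat J I G" if "J \<subseteq> I" for J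
    using that unfolding ext_equivalent_def by (blast dest: ext_theorem_ht_sat ht_sat_Iff)
  then show "stable_model \<sigma> (H \<union> {F}) I \<longleftrightarrow> stable_model \<sigma> (H \<union> {G}) I"
    by (intro stable_model_cong) auto
qed

end
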